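(* Let $S \subset \mathrm{Sym}(\mathbf N)$ be a generating set such that $S^{\mathrm{Cox}}_{\mathbf N} \subset S \subset T_{\mathbf N}$. For every $n \ge 1$, let $S_n \subset \mathrm{Sym}(n)$ be a generating set such that $S^{\mathrm{Cox}}_n \subset S_n \subset T_n$. Then: (i) $C_{\mathrm{Sym}(\mathbf N), S}(q) = \sum_{m=0}^\infty p(m) q^m = \prod_{j=1}^\infty \frac{1}{1-q^j}$; in particular the sequence of coefficients of $C_{\mathrm{Sym}(\mathbf N), S}(q)$ is of intermediate growth (superpolynomial and subexponential); (ii) $C_{\mathrm{Sym}(n), S_n}(q) = \sum_{k=0}^{n-1} p_{n-k}(n) q^k$ for every $n \ge 1$; (iii) $\sum_{n=0}^\infty C_{\mathrm{Sym}(n), S_n}(q)\, t^n = \prod_{j=1}^\infty \frac{1}{1 - q^{j-1} t^j}$, where the $n=0$ term is $1$; (iv) when $n \to \infty$, the polynomials $C_{\mathrm{Sym}(n), S_n}(q)$ converge coefficientwise towards the series $C_{\mathrm{Sym}(\mathbf N), S}(q)$.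
   Context: $\mathbf N = \{0,1,2,\dots\}$. For a group $G$ generated by a set $S$: the word length $\ell_{G,S}(g)$ is the smallest $n \ge 0$ such that $g = s_1 \cdots s_n$ with $s_i \in S \cup S^{-1}$; the conjugacy length $\kappa_{G,S}(g)$ is the minimum of $\ell_{G,S}(h)$ over all $h$ in the conjugacy class of $g$; $\gamma_{G,S}(n)$ is the number of conjugacy classes of $G$ consisting of elements $g$ with $\kappa_{G,S}(g) = n$. When $\gamma_{G,S}(n)$ is finite for all $n$, the conjugacy growth series is $C_{G,S}(q) = \sum_{n=0}^\infty \gamma_{G,S}(n) q^n$. (Asserting a formula for $C_{G,S}$ includes the assertion that all $\gamma_{G,S}(n)$ are finite.) For a non-empty set $X$, $\mathrm{Sym}(X)$ is the finitary symmetric group, i.e. the group of permutations of $X$ with finite support; $\mathrm{Sym}(n) = \mathrm{Sym}(\{1,\dots,n\})$. $T_X$ is the set of all transpositions of $X$, and $T_n$ is the set of all transpositions of $\{1,\dots,n\}$. $S^{\mathrm{Cox}}_{\mathbf N} = \{(i,i+1) \mid i \in \mathbf N\}$ and $S^{\mathrm{Cox}}_n = \{(1,2),(2,3),\dots,(n-1,n)\}$. $p(m)$ is the number of partitions of $m$ (with $p(0)=1$), and $p_k(n)$ is the number of partitions of $n$ into exactly $k$ positive parts. *)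

theory Defs
  imports
    "HOL-Analysis.Infinite_Products"
    "HOL-Library.Multiset"
    "HOL-Library.Landau_Symbols"
    "HOL-Computational_Algebra.Formal_Power_Series"
    "HOL-Algebra.Sym_Groups"
begin

section \<open>Conjugacy growth of a group with respect to a generating set\<close>

definition word_length :: "('a, 'b) monoid_scheme \<Rightarrow> 'a set \<Rightarrow> 'a \<Rightarrow> nat" where
  "word_length G S g =
     (LEAST n. \<exists>ws. length ws = n \<and> set ws \<subseteq> S \<union> m_inv G ` S \<and> g = foldr (mult G) ws (one G))"

definition conj_class :: "('a, 'b) monoid_scheme \<Rightarrow> 'a \<Rightarrow> 'a set" where
  "conj_class G g = {x \<otimes>\<^bsub>G\<^esub> g \<otimes>\<^bsub>G\<^esub> inv\<^bsub>G\<^esub> x | x. x \<in> carrier G}"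

text \<open>The infimum is over a non-empty set of natural numbers, hence a minimum;
  conjugacy classes may be infinite, so \<open>Min\<close> is not applicable.\<close>

definition conj_length :: "('a, 'b) monoid_scheme \<Rightarrow> 'a set \<Rightarrow> 'a \<Rightarrow> nat" where
  "conj_length G S g = (INF h\<in>conj_class G g. word_length G S h)"

definition conj_classes_of_length :: "('a, 'b) monoid_scheme \<Rightarrow> 'a set \<Rightarrow> nat \<Rightarrow> 'a set set" where
  "conj_classes_of_length G S n = {conj_class G g | g. g \<in> carrier G \<and> conj_length G S g = n}"

text \<open>Since \<open>card\<close> is \<open>0\<close> on infinite sets, the next two definitions are meaningful only
  together with finiteness of \<^term>\<open>conj_classes_of_length G S n\<close> for all \<open>n\<close>.\<close>

definition conj_growth :: "('a, 'b) monoid_scheme \<Rightarrow> 'a set \<Rightarrow> nat \<Rightarrow> nat" where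
  "conj_growth G S n = card (conj_classes_of_length G S n)"

definition conj_growth_series :: "('a, 'b) monoid_scheme \<Rightarrow> 'a set \<Rightarrow> real fps" where
  "conj_growth_series G S = Abs_fps (\<lambda>n. real (conj_growth G S n))"


section \<open>Finitary symmetric groups\<close>

definition finitary_sym :: "'a set \<Rightarrow> ('a \<Rightarrow> 'a) monoid" where
  "finitary_sym X =
     \<lparr>carrier = {p. p permutes X \<and> finite {x. p x \<noteq> x}}, mult = (\<circ>), one = id\<rparr>"

lemma finitary_sym_is_group: "group (finitary_sym X)"
proof -
  have fin: "finite {x. (p \<circ> q) x \<noteq> x}" if "finite {x. p x \<noteq> x}" "finite {x. q x \<noteq> x}" for p q :: "'a\<Rightarrow>'a"
    by (rule finite_subset[OF _ finite_UnI[OF that]]) auto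
  have fin2: "finite {x. inv' p x \<noteq> x}" if "finite {x. p x \<noteq> x}" "p permutes X" for p :: "'a\<Rightarrow>'a"
    by (rule finite_subset[OF _ that(1)]) (use that(2) in \<open>auto simp: permutes_inv_eq\<close>)
  show ?thesis
    by (rule groupI)
      (auto simp: finitary_sym_def permutes_compose permutes_id comp_assoc
        intro!: fin exI[of _ "inv' _"] fin2 permutes_inv dest: permutes_inv_o(2)
        simp del: o_apply)
qed
lemma finitary_sym_eq_sym_group: "finitary_sym {1..n} = sym_group n"
proof -
  have "finite {x. p x \<noteq> x}" if "p permutes {1..n}" for p :: "nat \<Rightarrow> nat"
    by (rule finite_subset[of _ "{1..n}"]) (use that in \<open>auto simp: permutes_def\<close>)
  then show ?thesis
    unfolding finitary_sym_def sym_group_def by auto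
qed

definition transpositions :: "'a set \<Rightarrow> ('a \<Rightarrow> 'a) set" where
  "transpositions X = {Transposition.transpose a b | a b. a \<in> X \<and> b \<in> X \<and> a \<noteq> b}"

definition coxeter_gens_nat :: "(nat \<Rightarrow> nat) set" where
  "coxeter_gens_nat = {Transposition.transpose i (i + 1) | i. True}"

definition coxeter_gens :: "nat \<Rightarrow> (nat \<Rightarrow> nat) set" where
  "coxeter_gens n = {Transposition.transpose i (i + 1) | i. 1 \<le> i \<and> i + 1 \<le> n}"


section \<open>Integer partitions\<close>

definition partition_number :: "nat \<Rightarrow> nat" where
  "partition_number m = card {M :: nat multiset. 0 \<notin># M \<and> sum_mset M = m}"

definition partition_number_parts :: "nat \<Rightarrow> nat \<Rightarrow> nat" where
  "partition_number_parts k n =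
     card {M :: nat multiset. 0 \<notin># M \<and> sum_mset M = n \<and> size M = k}"


section \<open>Growth of sequences\<close>

definition superpolynomial :: "(nat \<Rightarrow> real) \<Rightarrow> bool" where
  "superpolynomial a \<longleftrightarrow> (\<forall>d::nat. (\<lambda>n. real n ^ d) \<in> o(a))"

definition subexponential :: "(nat \<Rightarrow> real) \<Rightarrow> bool" where
  "subexponential a \<longleftrightarrow> (\<forall>c::real. c > 1 \<longrightarrow> a \<in> o(\<lambda>n. c ^ n))"

definition intermediate_growth :: "(nat \<Rightarrow> real) \<Rightarrow> bool" where
  "intermediate_growth a \<longleftrightarrow> superpolynomial a \<and> subexponential a"

end

theory Submission
  imports Defs "HOL-Real_Asymp.Real_Asymp"
begin

text \<open>
  Record a cycle of length \<open>k + 1\<close> as \<open>k\<close>. The conjugacy classes of \<open>Sym(X)\<close> then correspond to the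
  multisets \<open>M\<close> of positive integers with \<open>\<Sum>M + |M| \<le> |X|\<close>, and the conjugacy length is \<open>\<Sum>M\<close> for every
  generating set between the Coxeter generators and the transpositions: a product of cycles on
  consecutive intervals is a word of length \<open>\<Sum>M\<close> in the Coxeter generators, while no product of
  fewer transpositions can connect the points of each cycle. For infinite \<open>X\<close> this counts partitions
  of \<open>\<Sum>M\<close>; for \<open>|X| = n\<close>, adding 1 to each element of \<open>M\<close> and filling up with ones gives the
  partitions of \<open>n\<close> into \<open>n - \<Sum>M\<close> parts. Both product formulas are instances of the weighted
  generating function of partitions in which a part \<open>j\<close> carries the weight \<open>a\<^bsub>j-1\<^esub>\<close>.

  The partition numbers grow subexponentially since \<open>\<Prod>\<^sub>j 1 / (1 - x\<^sup>j)\<close> converges for every \<open>0 < x < 1\<close>,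
  and superpolynomially since \<open>p(n) \<ge> 2\<^bsup>k-1\<^esup>\<close> whenever \<open>k\<^sup>2 \<le> n\<close>.
\<close>

section \<open>Partition numbers\<close>

lemma size_le_sum_mset: "0 \<notin># M \<Longrightarrow> size M \<le> sum_mset (M :: nat multiset)"
  by (induction M) auto

lemma finite_partitions: "finite {M :: nat multiset. 0 \<notin># M \<and> sum_mset M = n}"
proof (rule finite_subset)
  show "finite (mset ` {xs. set xs \<subseteq> {..n} \<and> length xs \<le> n})"
    by (intro finite_imageI finite_lists_length_le) auto
  show "{M. 0 \<notin># M \<and> sum_mset M = n} \<subseteq> mset ` {xs. set xs \<subseteq> {..n} \<and> length xs \<le> n}"
  proof
    fix M :: "nat multiset" assume M: "M \<in> {M. 0 \<notin># M \<and> sum_mset M = n}"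
    obtain xs where xs: "mset xs = M" using ex_mset by blast
    have "x \<le> n" if "x \<in># M" for x
      using M sum_mset.remove[OF that] by auto
    moreover have "size M \<le> n" using M size_le_sum_mset[of M] by auto
    ultimately show "M \<in> mset ` {xs. set xs \<subseteq> {..n} \<and> length xs \<le> n}"
      using xs by (intro image_eqI[of _ _ xs]) auto
  qed
qed

section \<open>Partitions with bounded parts and the partial products of their generating
  function\<close>

definition parts_upto :: "nat \<Rightarrow> nat \<Rightarrow> nat multiset set" where
  "parts_upto N n = {M. 0 \<notin># M \<and> sum_mset M = n \<and> (\<forall>x\<in>#M. x \<le> N)}"

lemma finite_parts_upto: "finite (parts_upto N n)"
  by (rule finite_subset[OF _ finite_partitions[of n]]) (auto simp: parts_upto_def)

lemma parts_upto_0: "parts_upto 0 n = (if n = 0 then {{#}} else {})"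
proof -
  have "M \<in> parts_upto 0 n \<longleftrightarrow> M = {#} \<and> n = 0" for M
    by (cases M) (auto simp: parts_upto_def)
  then show ?thesis by auto
qed

lemma parts_upto_eq_all:
  assumes "n \<le> N"
  shows "parts_upto N n = {M. 0 \<notin># M \<and> sum_mset M = n}"
proof -
  have "x \<le> sum_mset M" if "x \<in># M" for x and M :: "nat multiset"
    using sum_mset.remove[OF that] by simp
  with assms show ?thesis unfolding parts_upto_def by fastforce
qed

text \<open>Split according to whether \<open>Suc N\<close> occurs. Removing one copy may leave
  further copies, so the bound on the right stays \<open>Suc N\<close>; this is what produces a
  geometric factor.\<close>

lemma parts_upto_Suc:
  "parts_upto (Suc N) n = parts_upto N n \<union>
     (if Suc N \<le> n then add_mset (Suc N) ` parts_upto (Suc N) (n - Suc N) else {})"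
  (is "?L = ?R")
proof (intro equalityI subsetI)
  fix M assume M: "M \<in> ?L"
  show "M \<in> ?R"
  proof (cases "Suc N \<in># M")
    case True
    then obtain M' where M': "M = add_mset (Suc N) M'" by (metis insert_DiffM)
    with M show ?thesis by (auto simp: parts_upto_def)
  next
    case False
    with M show ?thesis by (force simp: parts_upto_def le_Suc_eq)
  qed
qed (force simp: parts_upto_def split: if_splits)+

text \<open>The summand is arbitrary so that weighted sums and, with \<open>h\<close> constantly 1,
  cardinalities obey the same recursion.\<close>

lemma sum_parts_upto_Suc:
  fixes h :: "nat multiset \<Rightarrow> 'a::comm_monoid_add"
  shows "sum h (parts_upto (Suc N) n) = sum h (parts_upto N n) +
     (if Suc N \<le> n then \<Sum>M\<in>parts_upto (Suc N) (n - Suc N). h (add_mset (Suc N) M) else 0)"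
proof -
  have disj: "parts_upto N n \<inter> add_mset (Suc N) ` parts_upto (Suc N) (n - Suc N) = {}"
  proof (rule Int_emptyI)
    fix M assume "M \<in> parts_upto N n" "M \<in> add_mset (Suc N) ` parts_upto (Suc N) (n - Suc N)"
    then have "\<forall>x\<in>#M. x \<le> N" "Suc N \<in># M" by (simp add: parts_upto_def, force)
    then show False by fastforce
  qed
  show ?thesis
  proof (cases "Suc N \<le> n")
    case True
    then have "parts_upto (Suc N) n = parts_upto N n \<union> add_mset (Suc N) ` parts_upto (Suc N) (n - Suc N)"
      using parts_upto_Suc[of N n] by simp
    then have "sum h (parts_upto (Suc N) n)
        = sum h (parts_upto N n) + sum h (add_mset (Suc N) ` parts_upto (Suc N) (n - Suc N))"
      using sum.union_disjoint[OF finite_parts_upto finite_imageI[OF finite_parts_upto] disj, of h] by simp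
    moreover have "inj_on (add_mset (Suc N)) (parts_upto (Suc N) (n - Suc N))" by (simp add: inj_on_def)
    ultimately show ?thesis using True by (simp add: sum.reindex comp_def)
  next
    case False
    then show ?thesis using parts_upto_Suc[of N n] by simp
  qed
qed

text \<open>The weights used later are \<open>a j = 1\<close> for ordinary partitions and
  \<open>a j = fps_X ^ j\<close> for the two-variable product, where the coefficients are themselves
  power series.\<close>

definition parts_fps :: "(nat \<Rightarrow> 'a::comm_semiring_1) \<Rightarrow> nat \<Rightarrow> 'a fps" where
  "parts_fps a N = Abs_fps (\<lambda>n. \<Sum>M\<in>parts_upto N n. \<Prod>x\<in>#M. a (x - 1))"

lemma parts_fps_0: "parts_fps a 0 = 1"
  by (rule fps_ext) (simp add: parts_fps_def parts_upto_0)

lemma parts_fps_Suc: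
  fixes a :: "nat \<Rightarrow> 'a::comm_ring_1"
  shows "(1 - fps_const (a N) * fps_X ^ (N + 1)) * parts_fps a (Suc N) = parts_fps a N"
proof (rule fps_ext)
  fix n
  show "fps_nth ((1 - fps_const (a N) * fps_X ^ (N + 1)) * parts_fps a (Suc N)) n
      = fps_nth (parts_fps a N) n"
    by (simp add: left_diff_distrib mult.assoc fps_X_power_mult_nth parts_fps_def
        sum_parts_upto_Suc[of _ N n] sum_distrib_left del: power_Suc)
qed

text \<open>The class \<open>inverse\<close> carries no laws and the coefficients may be power
  series, so the one fact needed about the constant term 1 of each factor is assumed.\<close>

lemma prod_inverse_eq_parts_fps:
  fixes a :: "nat \<Rightarrow> 'a::{comm_ring_1,inverse}"
  assumes "inverse (1 :: 'a) = 1"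
  shows "(\<Prod>j<N. inverse (1 - fps_const (a j) * fps_X ^ (j + 1))) = parts_fps a N"
proof (induction N)
  case 0
  show ?case by (simp add: parts_fps_0)
next
  case (Suc N)
  let ?f = "1 - fps_const (a N) * fps_X ^ (N + 1)"
  have "?f * inverse ?f = 1"
    unfolding fps_inverse_def using assms by (intro fps_right_inverse) simp
  moreover have "parts_fps a N * inverse ?f = (?f * inverse ?f) * parts_fps a (Suc N)"
    unfolding parts_fps_Suc[of a N, symmetric] by (simp only: ac_simps)
  ultimately have "parts_fps a N * inverse ?f = parts_fps a (Suc N)" by simp
  with Suc.IH show ?case by simp
qed

text \<open>A partition of \<open>n\<close> has no part above \<open>n\<close>, so coefficient
  \<open>n\<close> of the partial products is constant as soon as \<open>n\<close> factors are
  present.\<close>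

lemma has_prod_parts:
  fixes a :: "nat \<Rightarrow> 'a::{comm_ring_1,inverse}"
  assumes "inverse (1 :: 'a) = 1"
  shows "(\<lambda>j. inverse (1 - fps_const (a j) * fps_X ^ (j + 1))) has_prod
    Abs_fps (\<lambda>n. \<Sum>M | 0 \<notin># M \<and> sum_mset M = n. \<Prod>x\<in>#M. a (x - 1))" (is "?f has_prod ?F")
proof -
  have "(\<lambda>n. \<Prod>j\<le>n. ?f j) \<longlonglongrightarrow> ?F"
  proof (rule tendsto_fpsI)
    fix n
    show "\<forall>\<^sub>F k in sequentially. fps_nth (\<Prod>j\<le>k. ?f j) n = fps_nth ?F n"
      using eventually_ge_at_top[of n]
    proof eventually_elim
      case (elim k)
      have "(\<Prod>j\<le>k. ?f j) = parts_fps a (Suc k)"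
        unfolding lessThan_Suc_atMost[symmetric] by (rule prod_inverse_eq_parts_fps[OF assms])
      with elim show ?case by (simp add: parts_fps_def parts_upto_eq_all)
    qed
  qed
  \<comment> \<open>The predicate \<open>raw_has_prod\<close> demands a nonzero limit, which the
    constant term guarantees.\<close>
  moreover have "fps_nth ?F 0 = 1"
  proof -
    have "{M :: nat multiset. 0 \<notin># M \<and> sum_mset M = 0} = {{#}}"
      using parts_upto_eq_all[of 0 0] parts_upto_0[of 0] by simp
    then show ?thesis by simp
  qed
  then have "?F \<noteq> 0" by (metis fps_zero_nth zero_neq_one)
  ultimately show ?thesis by (simp add: has_prod_def raw_has_prod_def)
qed

section \<open>Subexponential growth of the partition numbers\<close>

lemma weighted_parts_le_prod:
  fixes x :: real
  assumes "0 < x" "x < 1"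
  shows "(\<Sum>n\<le>K. card (parts_upto N n) * x ^ n) \<le> (\<Prod>j<N. 1 / (1 - x ^ Suc j))"
proof (induction N)
  case 0
  have "(\<Sum>n\<le>K. card (parts_upto 0 n) * x ^ n) = (\<Sum>n\<le>K. if n = 0 then 1 else 0)"
    by (intro sum.cong) (auto simp: parts_upto_0)
  then show ?case by simp
next
  case (Suc N)
  \<comment> \<open>Truncation at \<open>K\<close> keeps all sums finite. The shifted sum in the
    recursion then runs over a smaller range, so the product identity becomes the inequality
    \<open>?A (Suc N) * (1 - x ^ Suc N) \<le> ?A N\<close>.\<close>
  let ?A = "\<lambda>N. (\<Sum>n\<le>K. card (parts_upto N n) * x ^ n)"
  have card_eq: "card (parts_upto (Suc N) n) = card (parts_upto N n) +
      (if Suc N \<le> n then card (parts_upto (Suc N) (n - Suc N)) else 0)" for n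
    using sum_parts_upto_Suc[of "\<lambda>_. 1 :: nat" N n] by simp
  have "?A (Suc N) = ?A N +
      (\<Sum>n\<le>K. if Suc N \<le> n then card (parts_upto (Suc N) (n - Suc N)) * x ^ n else 0)"
    unfolding sum.distrib[symmetric] by (intro sum.cong) (auto simp: card_eq[of _] algebra_simps)
  also have "(\<Sum>n\<le>K. if Suc N \<le> n then card (parts_upto (Suc N) (n - Suc N)) * x ^ n else 0)
      = (\<Sum>n\<in>{Suc N..K}. card (parts_upto (Suc N) (n - Suc N)) * x ^ n)"
    by (intro sum.mono_neutral_cong_right) auto
  also have "\<dots> = (\<Sum>n\<in>(\<lambda>n. n - Suc N) ` {Suc N..K}. card (parts_upto (Suc N) n) * x ^ (n + Suc N))"
    by (subst sum.reindex) (auto simp: inj_on_def simp del: power_Suc intro!: sum.cong)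
  also have "\<dots> \<le> (\<Sum>n\<le>K. card (parts_upto (Suc N) n) * x ^ (n + Suc N))"
    using assms by (intro sum_mono2) auto
  also have "\<dots> = x ^ Suc N * ?A (Suc N)"
    by (simp add: sum_distrib_left power_add algebra_simps)
  finally have "?A (Suc N) * (1 - x ^ Suc N) \<le> ?A N" by (simp add: algebra_simps)
  moreover have "x ^ Suc N < 1" using assms power_Suc_less_one by blast
  ultimately have "?A (Suc N) \<le> ?A N * (1 / (1 - x ^ Suc N))" by (simp add: field_simps)
  also have "\<dots> \<le> (\<Prod>j<N. 1 / (1 - x ^ Suc j)) * (1 / (1 - x ^ Suc N))"
    using \<open>x ^ Suc N < 1\<close> by (intro mult_right_mono Suc.IH) auto
  finally show ?case by simp
qed

text \<open>A single term of the truncated generating function is at most the partial product. The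
  bound is independent of \<open>n\<close> because each factor is at most
  \<open>exp (x ^ j / (1 - x))\<close> and these exponents form a convergent geometric
  series.\<close>

lemma partition_number_mult_power_le:
  fixes x :: real
  assumes "0 < x" "x < 1"
  shows "partition_number n * x ^ n \<le> exp (1 / (1 - x) / (1 - x))"
proof -
  have "partition_number n * x ^ n = card (parts_upto n n) * x ^ n"
    by (simp add: partition_number_def parts_upto_eq_all)
  also have "\<dots> \<le> (\<Sum>k\<le>n. card (parts_upto n k) * x ^ k)"
    using assms by (intro member_le_sum) auto
  also have "\<dots> \<le> (\<Prod>j<n. 1 / (1 - x ^ Suc j))" by (rule weighted_parts_le_prod[OF assms])
  also have "\<dots> \<le> (\<Prod>j<n. exp (x ^ j / (1 - x)))"
  proof (rule prod_mono, safe)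
    fix j
    have pow: "x ^ Suc j \<le> x" "x ^ Suc j \<le> x ^ j"
      using assms power_decreasing[of 1 "Suc j" x] power_decreasing[of j "Suc j" x] by auto
    then have less: "x ^ Suc j < 1" using assms by linarith
    then show "0 \<le> 1 / (1 - x ^ Suc j)" by simp
    have "1 / (1 - x ^ Suc j) = 1 + x ^ Suc j / (1 - x ^ Suc j)" using less by (simp add: field_simps)
    also have "x ^ Suc j / (1 - x ^ Suc j) \<le> x ^ j / (1 - x)"
      using pow assms by (intro frac_le) auto
    also have "1 + x ^ j / (1 - x) \<le> exp (x ^ j / (1 - x))" by (rule exp_ge_add_one_self)
    finally show "1 / (1 - x ^ Suc j) \<le> exp (x ^ j / (1 - x))" by simp
  qed
  also have "\<dots> = exp (\<Sum>j<n. x ^ j / (1 - x))" by (simp add: exp_sum)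
  also have "\<dots> \<le> exp (1 / (1 - x) / (1 - x))"
  proof -
    have "(\<Sum>j<n. x ^ j) \<le> (\<Sum>j. x ^ j)"
      using assms by (intro sum_le_suminf summable_geometric) auto
    also have "\<dots> = 1 / (1 - x)" using assms by (intro suminf_geometric) auto
    finally have "(\<Sum>j<n. x ^ j) / (1 - x) \<le> 1 / (1 - x) / (1 - x)"
      using assms by (intro divide_right_mono) auto
    then show ?thesis by (simp add: sum_divide_distrib)
  qed
  finally show ?thesis .
qed

lemma subexponential_partition_number: "subexponential (\<lambda>n. real (partition_number n))"
  unfolding subexponential_def
proof safe
  fix c :: real assume c: "c > 1"
  \<comment> \<open>The midpoint of \<open>1 / c\<close> and 1, so that \<open>1 / x\<close> lies
    strictly between 1 and \<open>c\<close>.\<close>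
  define x where "x = (1 / c + 1) / 2"
  have x: "0 < x" "x < 1" "c * x > 1" using c by (auto simp: x_def field_simps)
  define C where "C = exp (1 / (1 - x) / (1 - x))"
  have "(\<lambda>n. real (partition_number n)) \<in> O(\<lambda>n. (1 / x) ^ n)"
  proof (rule bigoI[of _ C], rule always_eventually, safe)
    fix n
    show "norm (real (partition_number n)) \<le> C * norm ((1 / x) ^ n)"
      using partition_number_mult_power_le[OF x(1,2), of n] x
      by (simp add: C_def power_divide field_simps)
  qed
  also have "(\<lambda>n. (1 / x) ^ n) \<in> o(\<lambda>n. c ^ n)"
  proof (rule smalloI_tendsto)
    have "(\<lambda>n. (1 / (c * x)) ^ n) \<longlonglongrightarrow> 0"
      using x by (intro LIMSEQ_power_zero) auto
    then show "(\<lambda>n. (1 / x) ^ n / c ^ n) \<longlonglongrightarrow> 0"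
      by (simp add: power_divide power_mult_distrib mult.commute)
  qed (use c in auto)
  finally show "(\<lambda>n. real (partition_number n)) \<in> o(\<lambda>n. c ^ n)" .
qed

section \<open>Superpolynomial growth of the partition numbers\<close>

text \<open>Every \<open>A \<subseteq> {2..k}\<close> has sum at most \<open>k\<^sup>2\<close>, so it can be filled up with ones to a partition
  of \<open>n\<close>.\<close>

lemma partition_number_ge:
  assumes "k ^ 2 \<le> n"
  shows "2 ^ (k - 1) \<le> partition_number n"
proof -
  define h where "h A = mset_set A + replicate_mset (n - \<Sum>A) 1" for A :: "nat set"
  have fin: "finite A" if "A \<in> Pow {2..k}" for A using that finite_subset by auto
  \<comment> \<open>The set \<open>A\<close> is read off from \<open>h A\<close> as its entries of
    at least 2, whatever the number of ones added.\<close>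
  have "inj_on h (Pow {2..k})"
  proof (rule inj_on_inverseI)
    fix A assume A: "A \<in> Pow {2..k}"
    then show "{x \<in> set_mset (h A). 2 \<le> x} = A"
      using fin[OF A] by (auto simp: h_def)
  qed
  moreover have "h ` Pow {2..k} \<subseteq> {M. 0 \<notin># M \<and> sum_mset M = n}"
  proof safe
    fix A assume A: "A \<subseteq> {2..k}"
    then have fA: "finite A" using fin by auto
    have "\<Sum>A \<le> (\<Sum>x\<in>A. k)" using A by (intro sum_mono) auto
    also have "\<dots> \<le> k * k" using card_mono[OF _ A] by (auto intro: order_trans)
    finally have "\<Sum>A \<le> n" using assms by (simp add: power2_eq_square)
    moreover have "\<Sum>\<^sub># (mset_set A) = \<Sum>A" by (simp add: sum_unfold_sum_mset)
    ultimately show "\<Sum>\<^sub># (h A) = n" by (simp add: h_def sum_mset_replicate_mset)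
    show "0 \<in># h A \<Longrightarrow> False" using A fA by (auto simp: h_def split: if_splits)
  qed
  ultimately have "card (Pow {2..k}) \<le> partition_number n"
    unfolding partition_number_def by (rule card_inj_on_le[OF _ _ finite_partitions])
  then show ?thesis by (simp add: card_Pow)
qed

lemma superpolynomial_partition_number: "superpolynomial (\<lambda>n. real (partition_number n))"
  unfolding superpolynomial_def
proof safe
  fix d
  \<comment> \<open>With \<open>k\<close> the integer part of \<open>sqrt n\<close>, the exponent
    \<open>k - 1\<close> is at least \<open>sqrt n - 2\<close>, and this already outgrows every
    polynomial.\<close>
  have "(\<lambda>n. real n ^ d) \<in> o(\<lambda>n. 2 powr (sqrt (real n) - 2))" by real_asymp
  also have "(\<lambda>n. 2 powr (sqrt (real n) - 2)) \<in> O(\<lambda>n. real (partition_number n))"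
  proof (rule bigoI[of _ 1], rule always_eventually, safe)
    fix n
    define k where "k = nat \<lfloor>sqrt (real n)\<rfloor>"
    have "real (k ^ 2) \<le> (sqrt (real n)) ^ 2"
      unfolding of_nat_power k_def by (intro power_mono) auto
    then have "k ^ 2 \<le> n" by (simp flip: of_nat_power)
    then have "real (2 ^ (k - 1)) \<le> real (partition_number n)"
      using partition_number_ge of_nat_mono by blast
    moreover have "2 powr (sqrt (real n) - 2) \<le> 2 powr (real (k - 1))"
    proof (rule powr_mono)
      have "sqrt (real n) < real k + 1"
        unfolding k_def using floor_less_iff by (simp add: real_of_int_floor_add_one_gt)
      then show "sqrt (real n) - 2 \<le> real (k - 1)" by linarith
    qed auto
    ultimately have "2 powr (sqrt (real n) - 2) \<le> real (partition_number n)"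
      by (simp only: powr_realpow of_nat_power of_nat_numeral zero_less_numeral)
    then show "norm (2 powr (sqrt (real n) - 2)) \<le> 1 * norm (real (partition_number n))"
      by simp
  qed
  finally show "(\<lambda>n. real n ^ d) \<in> o(\<lambda>n. real (partition_number n))" .
qed


section \<open>Products of disjoint cycles\<close>

definition cycle_prod :: "'a list list \<Rightarrow> 'a \<Rightarrow> 'a" where
  "cycle_prod css = foldr (\<circ>) (map cycle_of_list css) id"

text \<open>Distinctness of the concatenation covers both the entries of each cycle and the
  disjointness of the cycles. Lists shorter than 2 act as the identity; excluding them makes the
  cycles correspond to the nontrivial orbits.\<close>

definition disjoint_cycles :: "'a list list \<Rightarrow> bool" where
  "disjoint_cycles css \<longleftrightarrow> distinct (concat css) \<and> (\<forall>cs\<in>set css. 2 \<le> length cs)"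

lemma cycle_prod_simps [simp]:
  "cycle_prod [] = id"
  "cycle_prod (cs # css) = cycle_of_list cs \<circ> cycle_prod css"
  by (simp_all add: cycle_prod_def)

lemma cycle_prod_permutes: "cycle_prod css permutes set (concat css)"
proof (induction css)
  case Nil
  show ?case by (simp add: permutes_id id_def[symmetric])
next
  case (Cons cs css)
  have "cycle_of_list cs permutes set (concat (cs # css))"
    by (rule permutes_subset[OF cycle_permutes]) auto
  moreover have "cycle_prod css permutes set (concat (cs # css))"
    by (rule permutes_subset[OF Cons.IH]) auto
  ultimately show ?case unfolding cycle_prod_simps by (metis permutes_compose)
qed

lemma cycle_prod_outside: "x \<notin> set (concat css) \<Longrightarrow> cycle_prod css x = x"
  using cycle_prod_permutes by (metis permutes_not_in)

lemma cycle_prod_inside: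
  assumes "distinct (concat css)" "cs \<in> set css" "x \<in> set cs"
  shows "cycle_prod css x = cycle_of_list cs x"
  using assms
proof (induction css)
  case (Cons c css)
  show ?case
  proof (cases "cs = c")
    case True
    then have "x \<notin> set (concat css)" using Cons.prems by auto
    then show ?thesis using True by (simp add: cycle_prod_outside del: set_concat)
  next
    case False
    then have cs: "cs \<in> set css" using Cons.prems by simp
    have "cycle_of_list cs x \<in> set cs"
      using Cons.prems(3) by (simp add: permutes_in_image[OF cycle_permutes])
    then have "cycle_of_list cs x \<notin> set c" using Cons.prems(1) cs by auto
    moreover have "cycle_prod css x = cycle_of_list cs x"
      using Cons cs by simp
    ultimately show ?thesis by (simp add: id_outside_supp)
  qed
qed simp

text \<open>The value at a point is decided by the one cycle that contains it, so the order of the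
  factors is irrelevant and they may be sorted.\<close>

lemma cycle_prod_cong:
  assumes "distinct (concat css)" "distinct (concat css')" "set css = set css'"
  shows "cycle_prod css = cycle_prod css'"
proof
  fix x
  show "cycle_prod css x = cycle_prod css' x"
  proof (cases "x \<in> set (concat css)")
    case True
    then obtain cs where "cs \<in> set css" "x \<in> set cs" by auto
    with assms show ?thesis by (metis cycle_prod_inside)
  next
    case False
    with assms(3) have "x \<notin> set (concat css')" by simp
    with False show ?thesis by (metis cycle_prod_outside)
  qed
qed

text \<open>\<open>cycle_decomp\<close> also admits cycles of length at most 1; they act as the
  identity and are dropped.\<close>

lemma ex_cycle_prod:
  assumes "p permutes X" "finite X"
  shows "\<exists>css. disjoint_cycles css \<and> set (concat css) \<subseteq> X \<and> p = cycle_prod css"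
  using cycle_decomposition[OF assms]
proof (induction rule: cycle_decomp.induct)
  case empty
  show ?case by (intro exI[of _ "[]"]) (simp add: disjoint_cycles_def)
next
  case (comp I p cs)
  then obtain css where css: "disjoint_cycles css" "set (concat css) \<subseteq> I" "p = cycle_prod css"
    by blast
  show ?case
  proof (cases "2 \<le> length cs")
    case True
    with css comp show ?thesis
      by (intro exI[of _ "cs # css"]) (auto simp: disjoint_cycles_def)
  next
    case False
    then have "cs = [] \<or> (\<exists>x. cs = [x])" by (cases cs; cases "tl cs") auto
    then have "cycle_of_list cs = id" by auto
    with css show ?thesis by (intro exI[of _ css]) auto
  qed
qed

text \<open>Sorting gives permutations of equal cycle type equal lists of cycle lengths, the form in
  which \<open>ex_conjugator\<close> compares them.\<close>

lemma ex_sorted_cycle_prod: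
  assumes "p permutes X" "finite X"
  shows "\<exists>css. disjoint_cycles css \<and> set (concat css) \<subseteq> X \<and> p = cycle_prod css
    \<and> sorted (map length css)"
proof -
  obtain css where css: "disjoint_cycles css" "set (concat css) \<subseteq> X" "p = cycle_prod css"
    using ex_cycle_prod[OF assms] by blast
  let ?css = "sort_key length css"
  have "mset (concat ?css) = mset (concat css)"
    by (simp add: mset_concat flip: sum_mset_sum_list)
  then have "distinct (concat ?css)"
    using css(1) mset_eq_imp_distinct_iff unfolding disjoint_cycles_def by blast
  with css(1) have "disjoint_cycles ?css" "cycle_prod ?css = cycle_prod css"
    unfolding disjoint_cycles_def by (auto intro!: cycle_prod_cong)
  moreover have "set (concat ?css) = set (concat css)" "sorted (map length ?css)" by simp_all
  ultimately show ?thesis using css by metis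
qed

lemma conjugation_cycle_prod:
  assumes "bij h" "distinct (concat css)"
  shows "h \<circ> cycle_prod css \<circ> inv_into UNIV h = cycle_prod (map (map h) css)"
  using assms(2)
proof (induction css)
  case Nil
  have "h \<circ> inv_into UNIV h = id" using bij_is_surj[OF assms(1)] unfolding surj_iff .
  then show ?case by (simp only: cycle_prod_simps comp_id list.map)
next
  case (Cons cs css)
  have "h \<circ> cycle_prod (cs # css) \<circ> inv_into UNIV h
      = (h \<circ> cycle_of_list cs \<circ> inv_into UNIV h) \<circ> (h \<circ> cycle_prod css \<circ> inv_into UNIV h)"
    using assms(1) by (simp add: fun_eq_iff bij_is_inj)
  also have "\<dots> = cycle_of_list (map h cs) \<circ> cycle_prod (map (map h) css)"
    using Cons assms(1) by (subst Cons.IH) (simp_all add: conjugation_of_cycle)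
  finally show ?case by (simp only: cycle_prod_simps list.map)
qed

lemma ex_map_eq:
  assumes "length xs = length ys" "distinct xs"
  shows "\<exists>f. map f xs = ys"
proof (intro exI)
  show "map (the \<circ> map_of (zip xs ys)) xs = ys"
    using assms by (intro nth_equalityI) (auto simp: map_of_zip_nth)
qed

text \<open>The bijection of \<open>set xs\<close> onto \<open>set ys\<close> extends to the union
  because the two complements have the same finite size. Staying inside the union later keeps
  conjugators finitary and inside \<open>X\<close>.\<close>

lemma ex_permutes_map_eq:
  assumes "length xs = length ys" "distinct xs" "distinct ys"
  shows "\<exists>h. h permutes set xs \<union> set ys \<and> map h xs = ys"
proof -
  let ?U = "set xs \<union> set ys"
  obtain f where f: "map f xs = ys" using ex_map_eq assms by blast
  then have bf: "bij_betw f (set xs) (set ys)"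
    using assms by (metis bij_betw_def distinct_map set_map)
  have "card (?U - set xs) = card (?U - set ys)"
    using assms by (subst (1 2) card_Diff_subset) (auto simp: distinct_card)
  then obtain g where bg: "bij_betw g (?U - set xs) (?U - set ys)"
    using finite_same_card_bij[of "?U - set xs" "?U - set ys"] by auto
  define h where "h x = (if x \<in> set xs then f x else if x \<in> ?U then g x else x)" for x
  have "bij_betw h (set xs \<union> (?U - set xs)) (set ys \<union> (?U - set ys))"
  proof (rule bij_betw_combine)
    show "bij_betw h (set xs) (set ys)"
      using bf by (rule bij_betw_cong[THEN iffD1, rotated]) (simp add: h_def)
    show "bij_betw h (?U - set xs) (?U - set ys)"
      using bg by (rule bij_betw_cong[THEN iffD1, rotated]) (auto simp: h_def)
  qed auto
  moreover have "set xs \<union> (?U - set xs) = ?U" "set ys \<union> (?U - set ys) = ?U" by auto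
  ultimately have "bij_betw h ?U ?U" by simp
  then have "h permutes ?U" by (rule bij_imp_permutes) (auto simp: h_def)
  moreover have "map h xs = ys" unfolding f[symmetric] by (simp add: h_def)
  ultimately show ?thesis by blast
qed

lemma ex_conjugator:
  assumes "distinct (concat css)" "distinct (concat css')" "map length css = map length css'"
  shows "\<exists>h. h permutes set (concat css) \<union> set (concat css') \<and>
    h \<circ> cycle_prod css \<circ> inv_into UNIV h = cycle_prod css'"
proof -
  have "length (concat css) = length (concat css')" by (simp add: length_concat assms(3))
  then obtain h where h: "h permutes set (concat css) \<union> set (concat css')"
      "map h (concat css) = concat css'"
    using ex_permutes_map_eq assms by blast
  \<comment> \<open>Equal block lengths let the equality of the concatenations be cut back into
    equalities of the single cycles.\<close>
  have "map (map h) css = css'"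
  proof (rule concat_injective)
    show "concat (map (map h) css) = concat css'" using h(2) by (simp add: map_concat)
    show "length (map (map h) css) = length css'" using assms(3) by (metis length_map)
    then show "\<forall>(x, y)\<in>set (zip (map (map h) css) css'). length x = length y"
      using assms(3) by (auto simp: set_zip) (metis length_map nth_map)
  qed
  with h(1) conjugation_cycle_prod[OF permutes_bij[OF h(1)] assms(1)] show ?thesis by auto
qed


section \<open>Cycle types\<close>

definition nontrivial_orbits :: "('a \<Rightarrow> 'a) \<Rightarrow> 'a set set" where
  "nontrivial_orbits p = {range (\<lambda>i. (p ^^ i) x) | x. p x \<noteq> x}"

text \<open>Fixed points are invisible, and a cycle of length \<open>k + 1\<close> is recorded as \<open>k\<close>, its contribution
  to the reflection length.\<close>

definition cycle_type :: "('a \<Rightarrow> 'a) \<Rightarrow> nat multiset" where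
  "cycle_type p = image_mset (\<lambda>B. card B - 1) (mset_set (nontrivial_orbits p))"

text \<open>On the points of \<open>cs\<close> the product acts as \<open>cycle_of_list cs\<close>
  alone, whose powers rotate the list and so carry \<open>x\<close> to every entry.\<close>

lemma orbit_cycle_prod:
  assumes "distinct (concat css)" "cs \<in> set css" "x \<in> set cs"
  shows "range (\<lambda>i. (cycle_prod css ^^ i) x) = set cs"
proof -
  let ?c = "cycle_of_list cs"
  have dist: "distinct cs" using assms by (meson distinct_concat_iff)
  have pow: "(cycle_prod css ^^ i) x = (?c ^^ i) x \<and> (?c ^^ i) x \<in> set cs" for i
    by (induction i) (use assms in \<open>auto simp: cycle_prod_inside permutes_in_image[OF cycle_permutes]\<close>)
  obtain k where k: "k < length cs" "x = cs ! k" using assms(3) by (metis in_set_conv_nth)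
  have "\<exists>i. cs ! j = (?c ^^ i) x" if j: "j < length cs" for j
  proof -
    \<comment> \<open>This many steps lead from position \<open>k\<close> to position
      \<open>j\<close>; the summand \<open>length cs\<close> prevents truncation when
      \<open>j < k\<close>.\<close>
    have "(?c ^^ (j + length cs - k)) x = rotate (j + length cs - k) cs ! k"
      using k by (simp flip: cyclic_rotation[OF dist])
    also have "\<dots> = cs ! ((j + length cs - k + k) mod length cs)"
      by (rule nth_rotate[OF k(1)])
    also have "(j + length cs - k + k) mod length cs = j" using j k by simp
    finally show ?thesis by metis
  qed
  then have "set cs \<subseteq> range (\<lambda>i. (?c ^^ i) x)"
    by (metis (no_types, lifting) in_set_conv_nth rangeI subsetI)
  then show ?thesis using pow by auto
qed

lemma cycle_prod_moves:
  assumes "disjoint_cycles css" "cs \<in> set css" "x \<in> set cs"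
  shows "cycle_prod css x \<noteq> x"
proof
  assume "cycle_prod css x = x"
  then have "(cycle_prod css ^^ i) x = x" for i by (induction i) auto
  then have "set cs = {x}"
    using orbit_cycle_prod[of css cs x] assms by (auto simp: disjoint_cycles_def)
  moreover have "distinct cs"
    using assms by (meson distinct_concat_iff disjoint_cycles_def)
  ultimately have "length cs = 1" by (metis distinct_card is_singletonI is_singleton_altdef)
  with assms show False by (auto simp: disjoint_cycles_def)
qed

lemma nontrivial_orbits_cycle_prod:
  assumes "disjoint_cycles css"
  shows "nontrivial_orbits (cycle_prod css) = set (map set css)"
proof -
  have dist: "distinct (concat css)" using assms by (simp add: disjoint_cycles_def)
  show ?thesis
  proof (intro equalityI subsetI)
    fix B assume "B \<in> nontrivial_orbits (cycle_prod css)"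
    then obtain x where x: "B = range (\<lambda>i. (cycle_prod css ^^ i) x)" "cycle_prod css x \<noteq> x"
      by (auto simp: nontrivial_orbits_def)
    then have "x \<in> set (concat css)" using cycle_prod_outside by metis
    then obtain cs where "cs \<in> set css" "x \<in> set cs" by auto
    with x orbit_cycle_prod[OF dist] show "B \<in> set (map set css)" by auto
  next
    fix B assume "B \<in> set (map set css)"
    then obtain cs where cs: "cs \<in> set css" "B = set cs" by auto
    with assms have "hd cs \<in> set cs" by (auto simp: disjoint_cycles_def intro!: hd_in_set)
    with cs assms dist show "B \<in> nontrivial_orbits (cycle_prod css)"
      unfolding nontrivial_orbits_def
      by (intro CollectI exI[of _ "hd cs"]) (auto simp: orbit_cycle_prod cycle_prod_moves)
  qed
qed

text \<open>The cycles are nonempty and disjoint, hence have different point sets, and passing to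
  the set of orbits loses no multiplicities.\<close>

lemma cycle_type_cycle_prod:
  assumes "disjoint_cycles css"
  shows "cycle_type (cycle_prod css) = mset (map (\<lambda>cs. length cs - 1) css)"
proof -
  have dist: "distinct (concat css)" using assms by (simp add: disjoint_cycles_def)
  have "[] \<notin> set css" using assms by (auto simp: disjoint_cycles_def)
  then have "distinct css" using dist by (simp add: distinct_concat_iff)
  moreover have "inj_on set (set css)"
    using dist \<open>[] \<notin> set css\<close> by (intro inj_onI) (metis distinct_concat_iff inf.idem set_empty)
  ultimately have "distinct (map set css)" by (simp add: distinct_map)
  then have "cycle_type (cycle_prod css) = mset (map (\<lambda>B. card B - 1) (map set css))"
    unfolding cycle_type_def nontrivial_orbits_cycle_prod[OF assms] mset_map[of "\<lambda>B. card B - 1"]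
    by (simp only: mset_set_set)
  also have "map (\<lambda>B. card B - 1) (map set css) = map (\<lambda>cs. length cs - 1) css"
    using dist by (auto simp: distinct_concat_iff distinct_card)
  finally show ?thesis .
qed

lemma cycle_type_conj:
  fixes h :: "'a \<Rightarrow> 'a"
  assumes "bij h"
  shows "cycle_type (h \<circ> p \<circ> inv_into UNIV h) = cycle_type p"
proof -
  let ?q = "h \<circ> p \<circ> inv_into UNIV h"
  have inj: "inj h" using assms by (rule bij_is_inj)
  have pow: "(?q ^^ i) (h x) = h ((p ^^ i) x)" for i x
    by (induction i) (auto simp: inj)
  have alt: "nontrivial_orbits q = (\<lambda>x. range (\<lambda>i. (q ^^ i) x)) ` {x. q x \<noteq> x}" for q :: "'a \<Rightarrow> 'a"
    by (auto simp: nontrivial_orbits_def)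
  have "{x. ?q x \<noteq> x} = h ` {x. p x \<noteq> x}"
  proof (intro equalityI subsetI)
    fix x assume x: "x \<in> {x. ?q x \<noteq> x}"
    obtain y where "x = h y" using bij_is_surj[OF assms] by (rule surjE)
    with x inj show "x \<in> h ` {x. p x \<noteq> x}" by auto
  qed (use inj in \<open>auto simp: inj_eq\<close>)
  then have "nontrivial_orbits ?q = (\<lambda>x. range (\<lambda>i. (?q ^^ i) (h x))) ` {x. p x \<noteq> x}"
    unfolding alt[of ?q] by (simp only: image_image)
  also have "\<dots> = (`) h ` nontrivial_orbits p"
    unfolding alt pow by (simp only: image_image)
  finally have "nontrivial_orbits ?q = (`) h ` nontrivial_orbits p" .
  moreover have "inj_on ((`) h) (nontrivial_orbits p)"
    using inj by (simp add: inj_on_def inj_image_eq_iff)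
  ultimately show ?thesis
    using inj unfolding cycle_type_def
    by (simp add: image_mset_mset_set[symmetric] card_image inj_on_subset multiset.map_comp comp_def)
qed


section \<open>Lower bound for the word length\<close>

text \<open>The function \<open>f\<close> plays the role of a choice of representatives for the connected components of
  the graph whose edges are the transpositions of the word: multiplying by one more transposition
  merges at most two components.\<close>

lemma ex_component_map:
  assumes "\<forall>t\<in>set ws. \<exists>a b. t = Transposition.transpose a b"
  shows "\<exists>f. f \<circ> foldr (\<circ>) ws id = f \<and> finite {x. f x \<noteq> x} \<and> card {x. f x \<noteq> x} \<le> length ws"
  using assms
proof (induction ws)
  case Nil
  show ?case by (intro exI[of _ id]) simp
next
  case (Cons t ws)
  let ?p = "foldr (\<circ>) ws id"
  obtain a b where t: "t = Transposition.transpose a b" using Cons.prems by auto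
  obtain f where f: "f \<circ> ?p = f" "finite {x. f x \<noteq> x}" "card {x. f x \<noteq> x} \<le> length ws"
    using Cons.IH Cons.prems by (meson list.set_intros(2))
  \<comment> \<open>\<open>g\<close> redirects the representative \<open>f a\<close> to
    \<open>f b\<close>, which merges the components of \<open>a\<close> and \<open>b\<close>; the
    only point that can become newly moved is \<open>f a\<close>.\<close>
  define g where "g = (id(f a := f b)) \<circ> f"
  have "g \<circ> t = g" by (auto simp: g_def t Transposition.transpose_def fun_eq_iff)
  moreover have "g \<circ> ?p = g" unfolding g_def by (simp add: comp_assoc f(1))
  ultimately have "g \<circ> foldr (\<circ>) (t # ws) id = g" by (metis comp_assoc foldr_Cons o_apply)
  moreover have sub: "{x. g x \<noteq> x} \<subseteq> insert (f a) {x. f x \<noteq> x}" by (auto simp: g_def)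
  moreover have "finite {x. g x \<noteq> x}" using finite_subset[OF sub] f(2) by simp
  moreover have "card {x. g x \<noteq> x} \<le> length (t # ws)"
    using card_mono[OF _ sub] f(2,3) by (auto simp: card_insert_if split: if_splits)
  ultimately show ?case by blast
qed

text \<open>\<open>f\<close> is constant on every cycle, so it fixes at most one of its points and
  moves at least \<open>length cs - 1\<close>; disjointness lets these counts be added.\<close>

lemma sum_cycle_type_le:
  assumes css: "disjoint_cycles css"
    and f: "f \<circ> cycle_prod css = f" "finite {x. f x \<noteq> x}"
  shows "sum_mset (cycle_type (cycle_prod css)) \<le> card {x. f x \<noteq> x}"
proof -
  let ?D = "{x. f x \<noteq> x}"
  have dist: "distinct (concat css)" using css by (simp add: disjoint_cycles_def)
  have cyc: "length cs - 1 \<le> card (?D \<inter> set cs)" if cs: "cs \<in> set css" for cs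
  proof -
    have pow: "f ((cycle_prod css ^^ i) x) = f x" for i x
      by (induction i) (use f(1) in \<open>auto simp: fun_eq_iff\<close>)
    have "f y = f x" if "x \<in> set cs" "y \<in> set cs" for x y
      using orbit_cycle_prod[OF dist cs that(1)] that(2) pow by (metis (no_types, lifting) imageE)
    then have "x = y" if "x \<in> set cs - ?D" "y \<in> set cs - ?D" for x y
      using that by (metis (mono_tags, lifting) DiffE mem_Collect_eq)
    then have "card (set cs - ?D) \<le> Suc 0" by (simp add: card_le_Suc0_iff_eq)
    moreover have "card (set cs) = length cs" using dist cs by (metis distinct_concat_iff distinct_card)
    moreover have "card (set cs) = card (?D \<inter> set cs) + card (set cs - ?D)"
      by (metis Int_commute card_Int_Diff finite_set)
    ultimately show ?thesis by linarith
  qed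
  have "sum_list (map (\<lambda>cs. length cs - 1) css) \<le> card (?D \<inter> set (concat css))"
    using dist cyc
  proof (induction css)
    case (Cons cs css)
    have "card (?D \<inter> set (concat (cs # css))) = card (?D \<inter> set cs) + card (?D \<inter> set (concat css))"
      using Cons.prems(1) by (subst card_Un_disjoint[symmetric]) (auto intro: arg_cong[of _ _ card])
    moreover have "length cs - 1 \<le> card (?D \<inter> set cs)" using Cons.prems(2) by simp
    moreover have "sum_list (map (\<lambda>cs. length cs - 1) css) \<le> card (?D \<inter> set (concat css))"
      using Cons.prems by (intro Cons.IH) auto
    ultimately show ?case by simp
  qed simp
  also have "\<dots> \<le> card ?D" using f(2) by (intro card_mono) auto
  finally show ?thesis unfolding cycle_type_cycle_prod[OF css] sum_mset_sum_list .
qed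


section \<open>Representatives of the conjugacy classes\<close>

text \<open>Consecutive points make every cycle a product of adjacent transpositions, so these
  representatives attain the lower bound with Coxeter generators alone.\<close>

fun interval_cycles :: "nat \<Rightarrow> nat list \<Rightarrow> nat list list" where
  "interval_cycles s [] = []"
| "interval_cycles s (m # ms) = [s..<s + m + 1] # interval_cycles (s + m + 1) ms"

lemma concat_interval_cycles:
  "concat (interval_cycles s ms) = [s..<s + sum_list ms + length ms]"
proof (induction ms arbitrary: s)
  case (Cons m ms)
  have "[s..<s + m + 1] @ [s + m + 1..<s + m + 1 + (sum_list ms + length ms)]
      = [s..<s + m + 1 + (sum_list ms + length ms)]"
    by (rule upt_add_eq_append[symmetric]) simp
  with Cons show ?case by (simp add: algebra_simps)
qed simp

lemma map_length_interval_cycles: "map length (interval_cycles s ms) = map Suc ms"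
  by (induction ms arbitrary: s) auto

lemma disjoint_cycles_interval_cycles:
  assumes "0 \<notin> set ms"
  shows "disjoint_cycles (interval_cycles s ms)"
proof -
  have "\<forall>cs\<in>set (interval_cycles s ms). 2 \<le> length cs"
    using assms by (induction ms arbitrary: s) auto
  then show ?thesis by (simp add: disjoint_cycles_def concat_interval_cycles del: distinct_concat)
qed

lemma foldr_comp_append: "foldr (\<circ>) (xs @ ys) id = foldr (\<circ>) xs id \<circ> foldr (\<circ>) ys id"
  by (induction xs) (auto simp: comp_assoc)

lemma cycle_of_list_upt:
  "cycle_of_list [s..<s + m + 1]
    = foldr (\<circ>) (map (\<lambda>i. Transposition.transpose i (i + 1)) [s..<s + m]) id"
proof (induction m arbitrary: s)
  case (Suc m)
  have "[s..<s + Suc m + 1] = s # Suc s # [Suc (Suc s)..<s + Suc m + 1]"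
       "[Suc s..<Suc s + m + 1] = Suc s # [Suc (Suc s)..<s + Suc m + 1]"
       "[s..<s + Suc m] = s # [Suc s..<Suc s + m]"
    by (simp_all add: upt_conv_Cons)
  then show ?case using Suc[of "Suc s"] by simp
qed simp

lemma ex_word_interval_cycles:
  "\<exists>ws. length ws = sum_list ms \<and>
     set ws \<subseteq> (\<lambda>i. Transposition.transpose i (i + 1)) ` {i. s \<le> i \<and> i + 1 < s + sum_list ms + length ms} \<and>
     cycle_prod (interval_cycles s ms) = foldr (\<circ>) ws id"
proof (induction ms arbitrary: s)
  case Nil
  show ?case by simp
next
  case (Cons m ms)
  let ?w = "map (\<lambda>i. Transposition.transpose i (i + 1)) [s..<s + m]"
  obtain ws where ws: "length ws = sum_list ms"
     "set ws \<subseteq> (\<lambda>i. Transposition.transpose i (i + 1)) `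
        {i. s + m + 1 \<le> i \<and> i + 1 < s + m + 1 + sum_list ms + length ms}"
     "cycle_prod (interval_cycles (s + m + 1) ms) = foldr (\<circ>) ws id"
    using Cons by blast
  have "cycle_prod (interval_cycles s (m # ms)) = foldr (\<circ>) (?w @ ws) id"
    using ws(3) by (simp only: interval_cycles.simps cycle_prod_simps cycle_of_list_upt foldr_comp_append)
  with ws(1,2) show ?case
    by (intro exI[of _ "?w @ ws"]) (fastforce simp: image_iff)
qed

text \<open>The standard representative of the cycle type \<open>M\<close>. Later \<open>s\<close>
  is the least point of the underlying set: 0 for \<open>UNIV\<close> and 1 for
  \<open>{1..n}\<close>.\<close>

definition interval_perm :: "nat \<Rightarrow> nat multiset \<Rightarrow> nat \<Rightarrow> nat" where
  "interval_perm s M = cycle_prod (interval_cycles s (sorted_list_of_multiset M))"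

lemma sum_list_sorted_list_of_multiset [simp]: "sum_list (sorted_list_of_multiset M) = sum_mset M"
  by (metis mset_sorted_list_of_multiset sum_mset_sum_list)

lemma length_sorted_list_of_multiset [simp]: "length (sorted_list_of_multiset M) = size M"
  by (metis mset_sorted_list_of_multiset size_mset)

lemma interval_perm_permutes: "interval_perm s M permutes {s..<s + sum_mset M + size M}"
  unfolding interval_perm_def
  using cycle_prod_permutes[of "interval_cycles s (sorted_list_of_multiset M)"]
  by (simp only: concat_interval_cycles set_upt
      sum_list_sorted_list_of_multiset length_sorted_list_of_multiset)

lemma cycle_type_interval_perm:
  assumes "0 \<notin># M"
  shows "cycle_type (interval_perm s M) = M"
proof -
  let ?ms = "sorted_list_of_multiset M"
  have "disjoint_cycles (interval_cycles s ?ms)"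
    using assms by (intro disjoint_cycles_interval_cycles) simp
  then have "cycle_type (interval_perm s M) = mset (map (\<lambda>l. l - 1) (map length (interval_cycles s ?ms)))"
    by (simp add: interval_perm_def cycle_type_cycle_prod comp_def)
  also have "map (\<lambda>l. l - 1) (map length (interval_cycles s ?ms)) = ?ms"
    by (simp add: map_length_interval_cycles comp_def)
  finally show ?thesis by simp
qed

text \<open>All claims come from one decomposition of \<open>p\<close> sorted by length. The
  conjugator moves only points of the support and of the interval, so it lies in the finitary group
  of \<open>X\<close> once the interval lies in \<open>X\<close>.\<close>

lemma cycle_type_normal_form:
  assumes "p permutes X" "finite {x. p x \<noteq> x}"
  shows "0 \<notin># cycle_type p" "finite X \<Longrightarrow> sum_mset (cycle_type p) + size (cycle_type p) \<le> card X"
    and "\<exists>h. h permutes {x. p x \<noteq> x} \<union> {s..<s + sum_mset (cycle_type p) + size (cycle_type p)} \<and>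
      h \<circ> p \<circ> inv_into UNIV h = interval_perm s (cycle_type p)"
proof -
  let ?U = "{x. p x \<noteq> x}" and ?M = "cycle_type p"
  have "p permutes ?U" using assms(1) by (rule permutes_superset) auto
  then obtain css where css: "disjoint_cycles css" "set (concat css) \<subseteq> ?U" "p = cycle_prod css"
      "sorted (map length css)"
    using ex_sorted_cycle_prod assms(2) by blast
  define ms where "ms = map (\<lambda>cs. length cs - 1) css"
  have lens: "map length css = map Suc ms"
    using css(1) by (auto simp: ms_def disjoint_cycles_def)
  have M: "?M = mset ms" using css by (simp add: cycle_type_cycle_prod ms_def)
  show no0: "0 \<notin># ?M" using css(1) by (auto simp: M ms_def disjoint_cycles_def)
  have "sorted ms"
    using css(4) unfolding lens by (simp add: sorted_map)
  then have ms: "sorted_list_of_multiset ?M = ms" by (simp add: M sorted_sort_id)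
  have size: "length (concat css) = sum_mset ?M + size ?M"
    unfolding length_concat lens M by (simp add: sum_list_Suc sum_mset_sum_list)
  have dist: "distinct (concat css)" using css by (simp add: disjoint_cycles_def)
  show "sum_mset ?M + size ?M \<le> card X" if "finite X"
  proof -
    have "set (concat css) \<subseteq> X" using css(2) assms(1) permutes_not_in by fastforce
    then have "card (set (concat css)) \<le> card X" by (rule card_mono[OF that])
    then show ?thesis unfolding distinct_card[OF dist] size .
  qed
  let ?css' = "interval_cycles s ms"
  have "disjoint_cycles ?css'"
    using no0 by (intro disjoint_cycles_interval_cycles) (simp add: M)
  then have "distinct (concat ?css')" by (simp add: disjoint_cycles_def)
  from ex_conjugator[OF dist this] lens obtain h where
    h: "h permutes set (concat css) \<union> set (concat ?css')" "h \<circ> p \<circ> inv_into UNIV h = cycle_prod ?css'"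
    unfolding map_length_interval_cycles css(3) by blast
  have "set (concat ?css') = {s..<s + sum_mset ?M + size ?M}"
    by (simp only: concat_interval_cycles set_upt) (simp add: M sum_mset_sum_list)
  then have "set (concat css) \<union> set (concat ?css') \<subseteq> ?U \<union> {s..<s + sum_mset ?M + size ?M}"
    using css(2) by blast
  with h(1) have "h permutes ?U \<union> {s..<s + sum_mset ?M + size ?M}" by (rule permutes_subset)
  with h(2) show "\<exists>h. h permutes ?U \<union> {s..<s + sum_mset ?M + size ?M} \<and>
      h \<circ> p \<circ> inv_into UNIV h = interval_perm s ?M"
    unfolding interval_perm_def ms by blast
qed


section \<open>Conjugacy classes of finitary symmetric groups\<close>

lemma finitary_sym_simps [simp]:
  "p \<in> carrier (finitary_sym X) \<longleftrightarrow> p permutes X \<and> finite {x. p x \<noteq> x}"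
  "mult (finitary_sym X) = (\<circ>)" "one (finitary_sym X) = id"
  by (simp_all add: finitary_sym_def)

lemma inv_finitary_sym:
  assumes "p \<in> carrier (finitary_sym X)"
  shows "m_inv (finitary_sym X) p = inv_into UNIV p"
proof -
  have "{x. inv_into UNIV p x \<noteq> x} = {x. p x \<noteq> x}"
    using assms by (auto simp: permutes_inv_eq)
  then have "inv_into UNIV p \<in> carrier (finitary_sym X)"
    using assms by (simp add: permutes_inv)
  with assms show ?thesis
    by (intro group.inv_equality[OF finitary_sym_is_group]) (auto simp: permutes_inv_o)
qed

lemma transposition_in_finitary_sym:
  assumes "t \<in> transpositions X"
  shows "t \<in> carrier (finitary_sym X)"
proof -
  obtain a b where t: "t = Transposition.transpose a b" "a \<in> X" "b \<in> X"
    using assms by (auto simp: transpositions_def)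
  have "{x. t x \<noteq> x} \<subseteq> {a, b}" by (auto simp: t Transposition.transpose_def)
  then have "finite {x. t x \<noteq> x}" by (rule finite_subset) simp
  with t show ?thesis by (simp add: permutes_swap_id)
qed

lemma (in group) conj_class_eq:
  assumes g: "g \<in> carrier G" and h: "h \<in> conj_class G g"
  shows "conj_class G h = conj_class G g"
proof -
  obtain x where x: "x \<in> carrier G" "h = x \<otimes> g \<otimes> inv x" using h by (auto simp: conj_class_def)
  show ?thesis
  proof (intro equalityI subsetI)
    fix k assume "k \<in> conj_class G h"
    then obtain y where y: "y \<in> carrier G" "k = y \<otimes> h \<otimes> inv y" by (auto simp: conj_class_def)
    then have "k = (y \<otimes> x) \<otimes> g \<otimes> inv (y \<otimes> x)"
      using x g by (simp add: inv_mult_group m_assoc)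
    then show "k \<in> conj_class G g" using x y unfolding conj_class_def by blast
  next
    fix k assume "k \<in> conj_class G g"
    then obtain y where y: "y \<in> carrier G" "k = y \<otimes> g \<otimes> inv y" by (auto simp: conj_class_def)
    have "inv x \<otimes> (x \<otimes> z) = z" if "z \<in> carrier G" for z
      using x(1) that by (simp flip: m_assoc)
    then have "k = (y \<otimes> inv x) \<otimes> h \<otimes> inv (y \<otimes> inv x)"
      using x y g by (simp add: inv_mult_group m_assoc)
    then show "k \<in> conj_class G h" using x y unfolding conj_class_def by blast
  qed
qed

lemma (in group) self_in_conj_class: "g \<in> carrier G \<Longrightarrow> g \<in> conj_class G g"
  unfolding conj_class_def by (intro CollectI exI[of _ \<one>]) simp

lemma conj_class_finitary_symD:
  assumes "g \<in> carrier (finitary_sym X)" "h \<in> conj_class (finitary_sym X) g"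
  shows "h \<in> carrier (finitary_sym X)" "cycle_type h = cycle_type g"
proof -
  interpret group "finitary_sym X" by (rule finitary_sym_is_group)
  obtain x where x: "x \<in> carrier (finitary_sym X)" "h = x \<circ> g \<circ> inv_into UNIV x"
    using assms(2) unfolding conj_class_def by (auto simp: inv_finitary_sym)
  show "h \<in> carrier (finitary_sym X)"
    using m_closed[OF m_closed[OF x(1) assms(1)] inv_closed[OF x(1)]]
    unfolding inv_finitary_sym[OF x(1)] x(2) finitary_sym_simps(2) .
  show "cycle_type h = cycle_type g"
    unfolding x(2) using x(1) by (intro cycle_type_conj) (auto intro: permutes_bij)
qed

text \<open>Treats \<open>UNIV\<close> with \<open>s = 0\<close> and \<open>{1..n}\<close> with
  \<open>s = 1\<close> together. By \<open>initial\<close>, \<open>X\<close> contains an interval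
  starting at \<open>s\<close> of every length for which it has room.\<close>

locale transposition_generated =
  fixes X :: "nat set" and s :: nat and S :: "(nat \<Rightarrow> nat) set"
  assumes gen: "generate (finitary_sym X) S = carrier (finitary_sym X)"
    and coxeter: "\<And>i. i \<in> X \<Longrightarrow> i + 1 \<in> X \<Longrightarrow> Transposition.transpose i (i + 1) \<in> S"
    and transp: "S \<subseteq> transpositions X"
    and initial: "\<And>N. (finite X \<Longrightarrow> N \<le> card X) \<Longrightarrow> {s..<s + N} \<subseteq> X"
begin

abbreviation "G \<equiv> finitary_sym X"

text \<open>A permutation of type \<open>M\<close> moves \<open>sum_mset M + size M\<close> points,
  so the last condition says that \<open>M\<close> fits into \<open>X\<close>; it is void for
  infinite \<open>X\<close>.\<close>

definition types :: "nat \<Rightarrow> nat multiset set" where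
  "types m = {M. 0 \<notin># M \<and> sum_mset M = m \<and> (finite X \<longrightarrow> sum_mset M + size M \<le> card X)}"

sublocale group G by (rule finitary_sym_is_group)

lemma letters_eq: "S \<union> m_inv G ` S = S"
proof -
  have "m_inv G t = t" if "t \<in> S" for t
  proof -
    have t: "t \<in> transpositions X" using that transp by blast
    then have "inv_into UNIV t = t" by (auto simp: transpositions_def)
    then show ?thesis using inv_finitary_sym[OF transposition_in_finitary_sym[OF t]] by simp
  qed
  then show ?thesis by auto
qed

text \<open>Ensures that the \<open>LEAST\<close> in \<open>word_length\<close> is attained.
  Inverses add no letters because transpositions are involutions.\<close>

lemma ex_word:
  assumes "g \<in> carrier G"
  shows "\<exists>ws. set ws \<subseteq> S \<and> g = foldr (\<circ>) ws id"
  using assms unfolding gen[symmetric]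
proof (induction rule: generate.induct)
  case one
  show ?case by (intro exI[of _ "[]"]) simp
next
  case (incl h)
  then show ?case by (intro exI[of _ "[h]"]) simp
next
  case (inv h)
  then have "m_inv G h \<in> S" using letters_eq by blast
  then show ?case by (intro exI[of _ "[m_inv G h]"]) simp
next
  case (eng h1 h2)
  then obtain ws1 ws2 where "set ws1 \<subseteq> S" "h1 = foldr (\<circ>) ws1 id" "set ws2 \<subseteq> S" "h2 = foldr (\<circ>) ws2 id"
    by blast
  then have "set (ws1 @ ws2) \<subseteq> S \<and> h1 \<otimes>\<^bsub>G\<^esub> h2 = foldr (\<circ>) (ws1 @ ws2) id"
    unfolding foldr_comp_append finitary_sym_simps by simp
  then show ?case by blast
qed

lemma word_length_eq:
  "word_length G S g = (LEAST n. \<exists>ws. length ws = n \<and> set ws \<subseteq> S \<and> g = foldr (\<circ>) ws id)"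
  by (simp add: word_length_def letters_eq)

text \<open>A shortest word yields a map \<open>f\<close> that moves at most as many points as the
  word has letters, while compatibility with the cycles of \<open>g\<close> forces it to move at
  least \<open>sum_mset (cycle_type g)\<close>.\<close>

lemma sum_cycle_type_le_word_length:
  assumes g: "g \<in> carrier G"
  shows "sum_mset (cycle_type g) \<le> word_length G S g"
proof -
  have "\<exists>n ws. length ws = n \<and> set ws \<subseteq> S \<and> g = foldr (\<circ>) ws id" using ex_word[OF g] by auto
  from LeastI_ex[OF this] obtain ws where
    ws: "length ws = word_length G S g" "set ws \<subseteq> S" "g = foldr (\<circ>) ws id"
    unfolding word_length_eq by blast
  have "\<forall>t\<in>set ws. \<exists>a b. t = Transposition.transpose a b"
    using ws(2) transp unfolding transpositions_def by blast
  from ex_component_map[OF this] obtain f where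
    f: "f \<circ> g = f" "finite {x. f x \<noteq> x}" "card {x. f x \<noteq> x} \<le> word_length G S g"
    unfolding ws(1) ws(3)[symmetric] by blast
  have "g permutes {x. g x \<noteq> x}" using g by (auto intro: permutes_superset)
  then obtain css where "disjoint_cycles css" "g = cycle_prod css"
    using ex_cycle_prod g by (metis finitary_sym_simps(1))
  then show ?thesis using sum_cycle_type_le[of css f] f by auto
qed

lemma interval_subset:
  assumes "M \<in> types m"
  shows "{s..<s + sum_mset M + size M} \<subseteq> X"
  unfolding add.assoc by (rule initial) (use assms in \<open>simp add: types_def\<close>)

lemma interval_perm_in_carrier:
  assumes "M \<in> types m"
  shows "interval_perm s M \<in> carrier G"
proof -
  let ?I = "{s..<s + sum_mset M + size M}"
  have "interval_perm s M permutes X"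
    using interval_perm_permutes interval_subset[OF assms] by (rule permutes_subset)
  moreover have "{x. interval_perm s M x \<noteq> x} \<subseteq> ?I"
    using interval_perm_permutes[of s M] by (auto simp: permutes_def)
  then have "finite {x. interval_perm s M x \<noteq> x}" by (rule finite_subset) simp
  ultimately show ?thesis by simp
qed

lemma word_length_interval_perm_le:
  assumes "M \<in> types m"
  shows "word_length G S (interval_perm s M) \<le> m"
proof -
  let ?I = "{s..<s + sum_mset M + size M}"
  have I: "?I \<subseteq> X" by (rule interval_subset[OF assms])
  obtain ws where ws: "length ws = sum_mset M" "interval_perm s M = foldr (\<circ>) ws id"
     "set ws \<subseteq> (\<lambda>i. Transposition.transpose i (i + 1)) ` {i. s \<le> i \<and> i + 1 < s + sum_mset M + size M}"
    using ex_word_interval_cycles[of "sorted_list_of_multiset M" s] unfolding interval_perm_def by auto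
  have "Transposition.transpose i (i + 1) \<in> S" if "s \<le> i" "i + 1 < s + sum_mset M + size M" for i
  proof (rule coxeter)
    show "i \<in> X" "i + 1 \<in> X" using that I by (auto intro!: subsetD[OF I])
  qed
  with ws(3) have "set ws \<subseteq> S" by blast
  with ws assms show ?thesis
    unfolding word_length_eq by (intro Least_le exI[of _ ws]) (auto simp: types_def)
qed

lemma cycle_type_in_types:
  assumes "g \<in> carrier G"
  shows "cycle_type g \<in> types (sum_mset (cycle_type g))"
  using cycle_type_normal_form(1,2)[of g X] assms by (auto simp: types_def)

lemma interval_perm_conj:
  assumes g: "g \<in> carrier G"
  shows "interval_perm s (cycle_type g) \<in> conj_class G g"
proof -
  let ?M = "cycle_type g"
  let ?I = "{s..<s + sum_mset ?M + size ?M}" and ?U = "{x. g x \<noteq> x}"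
  have g': "g permutes X" "finite ?U" using g by auto
  obtain h where h: "h permutes ?U \<union> ?I" "h \<circ> g \<circ> inv_into UNIV h = interval_perm s ?M"
    using cycle_type_normal_form(3)[OF g'] by blast
  have "?I \<subseteq> X" by (rule interval_subset[OF cycle_type_in_types[OF g]])
  moreover have "?U \<subseteq> X" using g' permutes_not_in by fastforce
  ultimately have "h permutes X" using permutes_subset[OF h(1)] by blast
  moreover have "{x. h x \<noteq> x} \<subseteq> ?U \<union> ?I" using h(1) permutes_not_in by fastforce
  then have "finite {x. h x \<noteq> x}" by (rule finite_subset) (use g' in auto)
  ultimately have hG: "h \<in> carrier G" by simp
  then show ?thesis
    unfolding conj_class_def using h(2) by (intro CollectI exI[of _ h]) (simp add: inv_finitary_sym)
qed

text \<open>The lower bound depends only on the cycle type, hence is the same on the whole class,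
  and the interval representative attains it.\<close>

lemma conj_length_eq:
  assumes g: "g \<in> carrier G"
  shows "conj_length G S g = sum_mset (cycle_type g)"
proof -
  let ?r = "interval_perm s (cycle_type g)"
  have lower: "sum_mset (cycle_type g) \<le> word_length G S h" if "h \<in> conj_class G g" for h
    using conj_class_finitary_symD[OF g that] sum_cycle_type_le_word_length by metis
  have "word_length G S ?r = sum_mset (cycle_type g)"
    using lower[OF interval_perm_conj[OF g]]
      word_length_interval_perm_le[OF cycle_type_in_types[OF g]] by (rule antisym[rotated])
  then show ?thesis
    unfolding conj_length_def using lower interval_perm_conj[OF g]
    by (intro cInf_eq_minimum) force+
qed

lemma conj_classes_of_length_eq:
  "conj_classes_of_length G S m = (\<lambda>M. conj_class G (interval_perm s M)) ` types m"
proof (intro equalityI subsetI)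
  fix C assume "C \<in> conj_classes_of_length G S m"
  then obtain g where g: "C = conj_class G g" "g \<in> carrier G" "conj_length G S g = m"
    by (auto simp: conj_classes_of_length_def)
  then have "C = conj_class G (interval_perm s (cycle_type g))"
    using conj_class_eq[OF g(2) interval_perm_conj[OF g(2)]] by simp
  moreover have "cycle_type g \<in> types m"
    using cycle_type_in_types[OF g(2)] conj_length_eq[OF g(2)] g(3) by simp
  ultimately show "C \<in> (\<lambda>M. conj_class G (interval_perm s M)) ` types m" by blast
next
  fix C assume "C \<in> (\<lambda>M. conj_class G (interval_perm s M)) ` types m"
  then obtain M where M: "M \<in> types m" "C = conj_class G (interval_perm s M)" by blast
  then have "conj_length G S (interval_perm s M) = m"
    using conj_length_eq[OF interval_perm_in_carrier[OF M(1)]] cycle_type_interval_perm[of M s]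
    by (simp add: types_def)
  with M interval_perm_in_carrier show "C \<in> conj_classes_of_length G S m"
    unfolding conj_classes_of_length_def by blast
qed

lemma inj_on_types: "inj_on (\<lambda>M. conj_class G (interval_perm s M)) (types m)"
proof (rule inj_onI)
  fix M N assume M: "M \<in> types m" and N: "N \<in> types m"
    and eq: "conj_class G (interval_perm s M) = conj_class G (interval_perm s N)"
  have "interval_perm s M \<in> conj_class G (interval_perm s N)"
    using self_in_conj_class[OF interval_perm_in_carrier[OF M]] eq by simp
  from conj_class_finitary_symD(2)[OF interval_perm_in_carrier[OF N] this]
  show "M = N" using M N by (simp add: cycle_type_interval_perm types_def)
qed

lemma finite_types: "finite (types m)"
  by (rule finite_subset[OF _ finite_partitions[of m]]) (auto simp: types_def)

lemma finite_conj_classes_of_length: "finite (conj_classes_of_length G S m)"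
  by (simp add: conj_classes_of_length_eq finite_types)

lemma conj_growth_eq: "conj_growth G S m = card (types m)"
  by (simp add: conj_growth_def conj_classes_of_length_eq card_image inj_on_types)

end


section \<open>Partitions with a given number of parts\<close>

text \<open>\<open>Q\<close> loses exactly the ones of \<open>P\<close>, and
  \<open>size P - size Q\<close> counts them, so \<open>P\<close> is determined by \<open>Q\<close>
  and its own number of parts.\<close>

lemma partition_decrement:
  assumes "0 \<notin># P"
  defines "Q \<equiv> filter_mset (\<lambda>x. x \<noteq> 0) (image_mset (\<lambda>x. x - 1) P)"
  shows "P = image_mset Suc Q + replicate_mset (size P - size Q) 1"
    and "sum_mset P = sum_mset Q + size P" and "size Q \<le> size P"
proof -
  have "P = image_mset Suc Q + replicate_mset (size P - size Q) 1 \<and>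
    sum_mset P = sum_mset Q + size P \<and> size Q \<le> size P"
    using assms(1) unfolding Q_def
  proof (induction P)
    case (add x P)
    then show ?case by (cases "x = 1") (auto simp: Suc_diff_le)
  qed simp
  then show "P = image_mset Suc Q + replicate_mset (size P - size Q) 1"
    "sum_mset P = sum_mset Q + size P" "size Q \<le> size P" by blast+
qed

lemma sum_mset_image_Suc: "sum_mset (image_mset Suc M) = sum_mset M + size M"
  by (induction M) auto

lemma card_partitions_increment:
  assumes "k \<le> n"
  shows "card {M. 0 \<notin># M \<and> sum_mset M = k \<and> sum_mset M + size M \<le> n} = partition_number_parts (n - k) n"
proof -
  \<comment> \<open>The added ones bring the number of parts to \<open>n - k\<close> and the sum to
    \<open>k + size M + (n - k - size M) = n\<close>.\<close>
  let ?f = "\<lambda>M. image_mset Suc M + replicate_mset (n - k - size M) 1"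
  let ?h = "\<lambda>P. filter_mset (\<lambda>x. x \<noteq> 0) (image_mset (\<lambda>x. x - 1) P) :: nat multiset"
  have "bij_betw ?f {M. 0 \<notin># M \<and> sum_mset M = k \<and> sum_mset M + size M \<le> n}
      {P. 0 \<notin># P \<and> sum_mset P = n \<and> size P = n - k}"
  proof (rule bij_betw_byWitness[where f' = ?h])
    show "\<forall>M\<in>{M. 0 \<notin># M \<and> sum_mset M = k \<and> sum_mset M + size M \<le> n}. ?h (?f M) = M"
    proof
      fix M assume "M \<in> {M. 0 \<notin># M \<and> sum_mset M = k \<and> sum_mset M + size M \<le> n}"
      then have "0 \<notin># M" by simp
      then have "?h (image_mset Suc M) = M" by (induction M) auto
      moreover have "?h (replicate_mset j 1) = {#}" for j by auto
      ultimately show "?h (?f M) = M" by (simp only: image_mset_union filter_union_mset add_0_right)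
    qed
    show "\<forall>P\<in>{P. 0 \<notin># P \<and> sum_mset P = n \<and> size P = n - k}. ?f (?h P) = P"
    proof
      fix P assume "P \<in> {P. 0 \<notin># P \<and> sum_mset P = n \<and> size P = n - k}"
      then have P: "0 \<notin># P" "size P = n - k" by simp_all
      show "?f (?h P) = P"
        using partition_decrement(1)[OF P(1)] unfolding P(2) by (rule sym)
    qed
    show "?f ` {M. 0 \<notin># M \<and> sum_mset M = k \<and> sum_mset M + size M \<le> n}
        \<subseteq> {P. 0 \<notin># P \<and> sum_mset P = n \<and> size P = n - k}"
      using assms by (auto simp: sum_mset_image_Suc split: if_splits)
    show "?h ` {P. 0 \<notin># P \<and> sum_mset P = n \<and> size P = n - k}
        \<subseteq> {M. 0 \<notin># M \<and> sum_mset M = k \<and> sum_mset M + size M \<le> n}"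
    proof
      fix M assume "M \<in> ?h ` {P. 0 \<notin># P \<and> sum_mset P = n \<and> size P = n - k}"
      then obtain P where P: "0 \<notin># P" "sum_mset P = n" "size P = n - k" "M = ?h P" by blast
      then show "M \<in> {M. 0 \<notin># M \<and> sum_mset M = k \<and> sum_mset M + size M \<le> n}"
        using partition_decrement(2,3)[OF P(1)] assms by auto
    qed
  qed
  then show ?thesis unfolding partition_number_parts_def by (rule bij_betw_same_card)
qed

lemma prod_mset_power_diff_one:
  assumes "0 \<notin># M"
  shows "(\<Prod>x\<in>#M. q ^ (x - 1)) = (q :: 'a::comm_semiring_1) ^ (sum_mset M - size M)"
  using assms
proof (induction M)
  case (add x M)
  then have "x - 1 + (sum_mset M - size M) = sum_mset (add_mset x M) - size (add_mset x M)"
    using size_le_sum_mset[of M] by auto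
  with add show ?case by (simp flip: power_add)
qed simp

text \<open>This is the coefficient of \<open>t ^ n\<close> in the two-variable product, with
  \<open>fps_X\<close> for \<open>q\<close>: a partition of \<open>n\<close> into
  \<open>n - k\<close> parts has weight \<open>q ^ k\<close>, and partitions are grouped by that
  exponent.\<close>

lemma sum_partitions_power:
  assumes "n \<ge> 1"
  shows "(\<Sum>M | 0 \<notin># M \<and> sum_mset M = n. \<Prod>x\<in>#M. fps_X ^ (x - 1)) =
    (\<Sum>k = 0..n - 1. of_nat (partition_number_parts (n - k) n) * fps_X ^ k :: real fps)"
proof -
  let ?P = "{M. 0 \<notin># M \<and> sum_mset M = n}"
  have "(\<Sum>M\<in>?P. \<Prod>x\<in>#M. fps_X ^ (x - 1)) = (\<Sum>M\<in>?P. fps_X ^ (n - size M) :: real fps)"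
  proof (rule sum.cong)
    fix M assume "M \<in> ?P"
    then show "(\<Prod>x\<in>#M. fps_X ^ (x - 1)) = (fps_X ^ (n - size M) :: real fps)"
      using prod_mset_power_diff_one[of M "fps_X :: real fps"] by simp
  qed simp
  also have "\<dots> = (\<Sum>k\<in>{0..n - 1}. \<Sum>M\<in>{M \<in> ?P. n - size M = k}. fps_X ^ (n - size M))"
  proof (rule sum.group[symmetric])
    show "(\<lambda>M. n - size M) ` ?P \<subseteq> {0..n - 1}"
    proof clarify
      fix M :: "nat multiset" assume "n = sum_mset M" "0 \<notin># M"
      \<comment> \<open>As \<open>n \<ge> 1\<close> there is at least one part, which caps the
        exponent at \<open>n - 1\<close>.\<close>
      with assms have "1 \<le> size M" by (cases M) auto
      then show "sum_mset M - size M \<in> {0..sum_mset M - 1}"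
        by (simp add: diff_le_mono2)
    qed
  qed (auto simp: finite_partitions)
  also have "\<dots> = (\<Sum>k = 0..n - 1. of_nat (partition_number_parts (n - k) n) * fps_X ^ k)"
  proof (rule sum.cong)
    fix k assume k: "k \<in> {0..n - 1}"
    then have "n - size M = k \<longleftrightarrow> size M = n - k" if "0 \<notin># M" "sum_mset M = n" for M
      using assms size_le_sum_mset[OF that(1)] that(2) by auto
    then have "{M \<in> ?P. n - size M = k} = {M. 0 \<notin># M \<and> sum_mset M = n \<and> size M = n - k}"
      by auto
    then show "(\<Sum>M\<in>{M \<in> ?P. n - size M = k}. fps_X ^ (n - size M)) =
        (of_nat (partition_number_parts (n - k) n) * fps_X ^ k :: real fps)"
      using k assms by (auto simp: partition_number_parts_def)
  qed simp
  finally show ?thesis .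
qed

(* Infinite products of formal power series converge in the adic topology that the library puts
   on fps, and are indexed from 0, so the j-th factor of the usual formula has index j - 1.
   In the third part the outer variable is t and the inner one is q. *)
theorem proposition1:
  fixes S :: "(nat \<Rightarrow> nat) set" and Sn :: "nat \<Rightarrow> (nat \<Rightarrow> nat) set"
  assumes "generate (finitary_sym UNIV) S = carrier (finitary_sym UNIV)"
    and "coxeter_gens_nat \<subseteq> S" and "S \<subseteq> transpositions UNIV"
    and "\<And>n. n \<ge> 1 \<Longrightarrow> generate (sym_group n) (Sn n) = carrier (sym_group n)"
    and "\<And>n. n \<ge> 1 \<Longrightarrow> coxeter_gens n \<subseteq> Sn n"
    and "\<And>n. n \<ge> 1 \<Longrightarrow> Sn n \<subseteq> transpositions {1..n}"
  shows
    "((\<forall>m. finite (conj_classes_of_length (finitary_sym UNIV) S m)) \<and>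
      conj_growth_series (finitary_sym UNIV) S = Abs_fps (\<lambda>m. real (partition_number m)) \<and>
      (\<lambda>j. inverse (1 - fps_X ^ (j + 1))) has_prod conj_growth_series (finitary_sym UNIV) S \<and>
      intermediate_growth (fps_nth (conj_growth_series (finitary_sym UNIV) S)))
   \<and> (\<forall>n\<ge>1. (\<forall>m. finite (conj_classes_of_length (sym_group n) (Sn n) m)) \<and>
        conj_growth_series (sym_group n) (Sn n) =
          (\<Sum>k = 0..n - 1. of_nat (partition_number_parts (n - k) n) * fps_X ^ k))
   \<and> (\<lambda>j. inverse (1 - fps_const (fps_X ^ j) * fps_X ^ (j + 1))) has_prod
        Abs_fps (\<lambda>n. if n = 0 then 1 else conj_growth_series (sym_group n) (Sn n))
   \<and> (\<forall>k. (\<lambda>n. fps_nth (conj_growth_series (sym_group n) (Sn n)) k)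
        \<longlonglongrightarrow> fps_nth (conj_growth_series (finitary_sym UNIV) S) k)"
proof -
  interpret N: transposition_generated UNIV 0 S
  proof
    show "Transposition.transpose i (i + 1) \<in> S" for i
      using assms(2) by (auto simp: coxeter_gens_nat_def)
  qed (use assms(1,3) in auto)
  have sym: "transposition_generated {1..n} 1 (Sn n)" if n: "n \<ge> 1" for n
  proof
    show "generate (finitary_sym {1..n}) (Sn n) = carrier (finitary_sym {1..n})"
      using assms(4)[OF n] by (simp only: finitary_sym_eq_sym_group)
    show "Transposition.transpose i (i + 1) \<in> Sn n" if "i \<in> {1..n}" "i + 1 \<in> {1..n}" for i
      using assms(5)[OF n] that by (auto simp: coxeter_gens_def)
    show "Sn n \<subseteq> transpositions {1..n}" by (rule assms(6)[OF n])
  qed auto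

  have growth_N: "conj_growth (finitary_sym UNIV) S m = partition_number m" for m
    by (simp add: N.conj_growth_eq N.types_def partition_number_def)
  then have series_N: "conj_growth_series (finitary_sym UNIV) S = Abs_fps (\<lambda>m. real (partition_number m))"
    by (simp add: conj_growth_series_def)

  have growth: "conj_growth (sym_group n) (Sn n) k
      = card {M. 0 \<notin># M \<and> sum_mset M = k \<and> sum_mset M + size M \<le> n}" if n: "n \<ge> 1" for n k
    using transposition_generated.conj_growth_eq[OF sym[OF n], of k]
    unfolding finitary_sym_eq_sym_group transposition_generated.types_def[OF sym[OF n]] by simp
  have series: "conj_growth_series (sym_group n) (Sn n) =
      (\<Sum>k = 0..n - 1. of_nat (partition_number_parts (n - k) n) * fps_X ^ k)" if n: "n \<ge> 1" for n
  proof (rule fps_ext)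
    fix k
    have "conj_growth (sym_group n) (Sn n) k = (if k \<le> n - 1 then partition_number_parts (n - k) n else 0)"
    proof (cases "k \<le> n - 1")
      case True
      then show ?thesis using card_partitions_increment[of k n] by (simp add: growth[OF n])
    next
      case False
      \<comment> \<open>Here \<open>k \<ge> n \<ge> 1\<close>, so \<open>M\<close> is nonempty and
        \<open>size M\<close> pushes the total above \<open>n\<close>.\<close>
      have "\<not> sum_mset M + size M \<le> n" if "sum_mset M = k" for M
        using that False by (cases M) auto
      then have none: "{M. 0 \<notin># M \<and> sum_mset M = k \<and> sum_mset M + size M \<le> n} = {}"
        by auto
      show ?thesis unfolding growth[OF n] none using False by simp
    qed
    moreover have "fps_nth (of_nat c * fps_X ^ j :: real fps) k = (if j = k then real c else 0)" for c j
      by (simp add: fps_X_power_mult_right_nth flip: fps_of_nat)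
    ultimately show "fps_nth (conj_growth_series (sym_group n) (Sn n)) k =
      fps_nth (\<Sum>k = 0..n - 1. of_nat (partition_number_parts (n - k) n) * fps_X ^ k) k"
      by (simp add: conj_growth_series_def fps_sum_nth sum.delta)
  qed

  have "(\<lambda>j. inverse (1 - fps_X ^ (j + 1))) has_prod conj_growth_series (finitary_sym UNIV) S"
    using has_prod_parts[of "\<lambda>_. 1 :: real"] by (simp add: series_N partition_number_def)
  moreover have "intermediate_growth (fps_nth (conj_growth_series (finitary_sym UNIV) S))"
    by (simp add: series_N intermediate_growth_def Abs_fps_inverse
        superpolynomial_partition_number subexponential_partition_number)
  moreover have "finite (conj_classes_of_length (sym_group n) (Sn n) m)" if "n \<ge> 1" for n m
    using transposition_generated.finite_conj_classes_of_length[OF sym[OF that]]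
    by (simp only: finitary_sym_eq_sym_group)
  moreover have "(\<lambda>j. inverse (1 - fps_const (fps_X ^ j) * fps_X ^ (j + 1))) has_prod
        Abs_fps (\<lambda>n. if n = 0 then 1 else conj_growth_series (sym_group n) (Sn n))"
  proof -
    have "(\<Sum>M | 0 \<notin># M \<and> sum_mset M = n. \<Prod>x\<in>#M. fps_X ^ (x - 1)) =
        (if n = 0 then 1 else conj_growth_series (sym_group n) (Sn n))" for n
    proof (cases "n = 0")
      case True
      have "{M :: nat multiset. 0 \<notin># M \<and> sum_mset M = 0} = {{#}}"
        using parts_upto_eq_all[of 0 0] parts_upto_0[of 0] by simp
      with True show ?thesis by simp
    qed (use sum_partitions_power[of n] series[of n] in simp)
    with has_prod_parts[of "\<lambda>j. fps_X ^ j :: real fps"] show ?thesis by simp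
  qed
  moreover have "(\<lambda>n. fps_nth (conj_growth_series (sym_group n) (Sn n)) k)
        \<longlonglongrightarrow> fps_nth (conj_growth_series (finitary_sym UNIV) S) k" for k
  proof (rule tendsto_eventually)
    show "\<forall>\<^sub>F n in sequentially. fps_nth (conj_growth_series (sym_group n) (Sn n)) k =
        fps_nth (conj_growth_series (finitary_sym UNIV) S) k"
      \<comment> \<open>A partition of \<open>k\<close> has at most \<open>k\<close> parts, so
        \<open>sum_mset M + size M \<le> 2 * k\<close> and the size restriction disappears; the
        extra 1 ensures \<open>n \<ge> 1\<close> when \<open>k = 0\<close>.\<close>
      using eventually_ge_at_top[of "2 * k + 1"]
    proof eventually_elim
      case (elim n)
      then have "sum_mset M + size M \<le> n" if "0 \<notin># M" "sum_mset M = k" for M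
        using size_le_sum_mset[OF that(1)] that(2) by simp
      then have "{M. 0 \<notin># M \<and> sum_mset M = k \<and> sum_mset M + size M \<le> n}
          = {M. 0 \<notin># M \<and> sum_mset M = k}"
        by auto
      with elim show ?case
        by (simp add: conj_growth_series_def growth growth_N partition_number_def)
    qed
  qed
  ultimately show ?thesis
    using N.finite_conj_classes_of_length series_N series by blast
qed

end
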